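(* Let $p\in\mathbb{N}$, $b\in\mathbb{C}\setminus\{0\}$, $a\in\mathbb{C}\setminus\{0\}$, $0\le\alpha<1$, $-\frac{\pi}{2}<\lambda<\frac{\pi}{2}$, and suppose that $2pab(1-\alpha)e^{-i\lambda}\cos\lambda\in\mathbf{B}$. If $f\in\mathcal{K}_p^{\lambda}(\alpha,b)$, then $$\left[\frac{f'(z)}{pz^{p-1}}\right]^{a}\prec\frac{1}{(1-z)^{2pab(1-\alpha)e^{-i\lambda}\cos\lambda}}\qquad(z\in\mathbb{U});$$ equivalently, for $f\in\mathcal{A}_p$, $$1+\frac{e^{i\lambda}}{b\cos\lambda}\left[\frac1p\left(1+\frac{zf''(z)}{f'(z)}\right)-1\right]\prec\frac{1+(1-2\alpha)z}{1-z}\ \Longrightarrow\ \left[\frac{f'(z)}{pz^{p-1}}\right]^{a}\prec\frac{1}{(1-z)^{2pab(1-\alpha)e^{-i\lambda}\cos\lambda}}.$$ Moreover $q(z)=(1-z)^{-2pab(1-\alpha)e^{-i\lambda}\cos\lambda}$ is the best dominant.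
   Context: $\mathbb{U}=\{z\in\mathbb{C}:|z|<1\}$. $\mathcal{A}_p$ is the class of analytic functions on $\mathbb{U}$ of the form $f(z)=z^p+\sum_{k=p+1}^\infty a_kz^k$. For $g,h$ analytic in $\mathbb{U}$, $g\prec h$ means $g=h\circ\omega$ for some analytic $\omega:\mathbb{U}\to\mathbb{U}$ with $\omega(0)=0$. $\mathbf{B}=\{z\in\mathbb{C}:|z+1|\le1\text{ or }|z-1|\le1\}$. All powers are principal, i.e. the analytic branches with value $1$ at $z=0$ ($f'(z)/(pz^{p-1})$ being given the value $1$ at $z=0$). $\mathcal{K}_p^{\lambda}(\alpha,b)$ is the class of $f\in\mathcal{A}_p$ such that, for $z\in\mathbb{U}$, $$\operatorname{Re}\left(\frac{1}{b\cos\lambda}\left[\frac{e^{i\lambda}}{p}\left(1+\frac{zf''(z)}{f'(z)}\right)-(1-b)\cos\lambda-i\sin\lambda\right]\right)>\alpha.$$ Best dominant: for a first-order differential subordination $\psi(\mathfrak{p}(z),z\mathfrak{p}'(z);z)\prec h(z)$, a function $q$ is a dominant if $\mathfrak{p}\prec q$ for all admissible analytic $\mathfrak{p}$ satisfying it; a univalent dominant $\tilde q$ with $\tilde q\prec q$ for all dominants $q$ is the best dominant. Here, with $\mathfrak{p}(z)=[f'(z)/(pz^{p-1})]^a$, the differential subordination is $1+\frac{e^{i\lambda}}{pab\cos\lambda}\frac{z\mathfrak{p}'(z)}{\mathfrak{p}(z)}\prec\frac{1+(1-2\alpha)z}{1-z}$, the admissible functions being the analytic nonvanishing $\mathfrak{p}$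 on $\mathbb{U}$ with $\mathfrak{p}(0)=1$. *)

theory Defs
  imports "HOL-Complex_Analysis.Complex_Analysis"
begin

abbreviation unit_disc :: "complex set" (\<open>\<U>\<close>) where
  "\<U> \<equiv> ball 0 1"

definition subordinate :: "(complex \<Rightarrow> complex) \<Rightarrow> (complex \<Rightarrow> complex) \<Rightarrow> bool"
    (infix \<open>\<prec>\<close> 50) where
  "g \<prec> h \<longleftrightarrow> g holomorphic_on \<U> \<and> h holomorphic_on \<U> \<and>
     (\<exists>\<omega>. \<omega> holomorphic_on \<U> \<and> \<omega> ` \<U> \<subseteq> \<U> \<and> \<omega> 0 = 0 \<and> (\<forall>z\<in>\<U>. g z = h (\<omega> z)))"

definition univalent :: "(complex \<Rightarrow> complex) \<Rightarrow> bool" where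
  "univalent q \<longleftrightarrow> q holomorphic_on \<U> \<and> inj_on q \<U>"

definition class_A :: "nat \<Rightarrow> (complex \<Rightarrow> complex) set" where
  "class_A p = {f. f holomorphic_on \<U> \<and>
     (\<exists>a. \<forall>z\<in>\<U>. (\<lambda>k. a (p + 1 + k) * z ^ (p + 1 + k)) sums (f z - z ^ p))}"

definition set_B :: "complex set" where
  "set_B = {z. norm (z + 1) \<le> 1 \<or> norm (z - 1) \<le> 1}"

text \<open>The function \<open>z f''(z) / f'(z)\<close>. For \<open>f\<close> in \<open>class_A p\<close> it has a removable singularity
  at 0 when \<open>p > 1\<close>, where the value is the limit \<open>p - 1\<close> (and not the \<open>0\<close> given by division
  by zero); for \<open>p = 1\<close> the value at 0 is \<open>0 = p - 1\<close> anyway.\<close>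

definition zf2_over_f1 :: "nat \<Rightarrow> (complex \<Rightarrow> complex) \<Rightarrow> complex \<Rightarrow> complex" where
  "zf2_over_f1 p f z =
     (if z = 0 then of_nat p - 1 else z * deriv (deriv f) z / deriv f z)"

definition normalized_deriv :: "nat \<Rightarrow> (complex \<Rightarrow> complex) \<Rightarrow> complex \<Rightarrow> complex" where
  "normalized_deriv p f z =
     (if z = 0 then 1 else deriv f z / (of_nat p * z ^ (p - 1)))"

text \<open>The condition \<open>deriv f z \<noteq> 0\<close> says that the quotient below is defined. At \<open>z = 0\<close> the
  expression whose real part is taken equals 1.\<close>

definition class_K :: "nat \<Rightarrow> real \<Rightarrow> real \<Rightarrow> complex \<Rightarrow> (complex \<Rightarrow> complex) set" where
  "class_K p lam \<alpha> b = {f \<in> class_A p.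
     (\<forall>z\<in>\<U> - {0}. deriv f z \<noteq> 0) \<and>
     (\<forall>z\<in>\<U>. Re (1 / (b * complex_of_real (cos lam)) *
        (exp (\<i> * complex_of_real lam) / of_nat p * (1 + zf2_over_f1 p f z)
         - (1 - b) * complex_of_real (cos lam) - \<i> * complex_of_real (sin lam))) > \<alpha>)}"

text \<open>Powers of a nonvanishing analytic function \<open>F\<close> on the disc with \<open>F 0 = 1\<close>: the analytic
  branch with value 1 at 0. This differs in general from \<open>\<lambda>z. F z powr a\<close>, because the values
  of \<open>F\<close> may cross the branch cut of \<open>Ln\<close>. The logarithm chosen below exists and is unique on
  the disc, as the two lemmas show.\<close>

definition is_disc_log :: "(complex \<Rightarrow> complex) \<Rightarrow> (complex \<Rightarrow> complex) \<Rightarrow> bool" where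
  "is_disc_log F L \<longleftrightarrow> L holomorphic_on \<U> \<and> L 0 = 0 \<and> (\<forall>z\<in>\<U>. exp (L z) = F z)"

definition branch_power :: "(complex \<Rightarrow> complex) \<Rightarrow> complex \<Rightarrow> complex \<Rightarrow> complex" where
  "branch_power F a z = exp (a * (SOME L. is_disc_log F L) z)"

lemma is_disc_log_exists:
  assumes "F holomorphic_on \<U>" "\<And>z. z \<in> \<U> \<Longrightarrow> F z \<noteq> 0" "F 0 = 1"
  shows "\<exists>L. is_disc_log F L"
proof -
  obtain g where g: "g holomorphic_on \<U>" "\<And>z. z \<in> \<U> \<Longrightarrow> F z = exp (g z)"
    using contractible_imp_holomorphic_log[OF assms(1) convex_imp_contractible[OF convex_ball]]
      assms(2) by metis
  have e: "exp (g 0) = 1" using g(2)[of 0] assms(3) by simp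
  have "is_disc_log F (\<lambda>z. g z - g 0)"
    unfolding is_disc_log_def using g e
    by (auto intro!: holomorphic_intros simp: exp_diff)
  then show ?thesis by blast
qed

lemma is_disc_log_unique:
  assumes "is_disc_log F L" "is_disc_log F M" "z \<in> \<U>"
  shows "L z = M z"
proof -
  have hol: "L holomorphic_on \<U>" "M holomorphic_on \<U>"
    and eq: "\<And>w. w \<in> \<U> \<Longrightarrow> exp (L w) = exp (M w)" and zero: "L 0 = 0" "M 0 = 0"
    using assms unfolding is_disc_log_def by auto
  have d: "((\<lambda>w. L w - M w) has_field_derivative 0) (at w within \<U>)" if w: "w \<in> \<U>" for w
  proof -
    have dL: "(L has_field_derivative deriv L w) (at w)"
      and dM: "(M has_field_derivative deriv M w) (at w)"
      using hol w holomorphic_derivI[OF _ open_ball] by blast+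
    have "((\<lambda>u. exp (L u)) has_field_derivative exp (L w) * deriv L w) (at w)"
      using dL by (auto intro!: derivative_eq_intros)
    then have "((\<lambda>u. exp (M u)) has_field_derivative exp (L w) * deriv L w) (at w)"
      by (rule has_field_derivative_transform_within_open[where S = \<U>]) (use w eq in auto)
    moreover have "((\<lambda>u. exp (M u)) has_field_derivative exp (M w) * deriv M w) (at w)"
      using dM by (auto intro!: derivative_eq_intros)
    ultimately have "exp (L w) * deriv L w = exp (M w) * deriv M w"
      by (rule DERIV_unique)
    then have "deriv L w = deriv M w" using eq[OF w] by simp
    then have "((\<lambda>w. L w - M w) has_field_derivative 0) (at w)"
      using DERIV_diff[OF dL dM] by simp
    then show ?thesis by (rule has_field_derivative_at_within)
  qed
  obtain c where c: "\<And>w. w \<in> \<U> \<Longrightarrow> L w - M w = c"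
    using has_field_derivative_zero_constant[OF convex_ball d] by blast
  show ?thesis using c[of 0] c[OF assms(3)] zero by simp
qed

text \<open>First-order differential subordinations \<open>\<psi> (P z, z P'(z); z) \<prec> h z\<close> over a class \<open>Adm\<close>
  of admissible functions \<open>P\<close>.\<close>

definition dominant ::
  "(complex \<Rightarrow> complex) set \<Rightarrow> (complex \<Rightarrow> complex \<Rightarrow> complex \<Rightarrow> complex) \<Rightarrow>
   (complex \<Rightarrow> complex) \<Rightarrow> (complex \<Rightarrow> complex) \<Rightarrow> bool" where
  "dominant Adm \<psi> h q \<longleftrightarrow>
     (\<forall>P\<in>Adm. (\<lambda>z. \<psi> (P z) (z * deriv P z) z) \<prec> h \<longrightarrow> P \<prec> q)"

definition best_dominant ::
  "(complex \<Rightarrow> complex) set \<Rightarrow> (complex \<Rightarrow> complex \<Rightarrow> complex \<Rightarrow> complex) \<Rightarrow>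
   (complex \<Rightarrow> complex) \<Rightarrow> (complex \<Rightarrow> complex) \<Rightarrow> bool" where
  "best_dominant Adm \<psi> h q \<longleftrightarrow>
     univalent q \<and> dominant Adm \<psi> h q \<and> (\<forall>r. dominant Adm \<psi> h r \<longrightarrow> q \<prec> r)"

definition admissible :: "(complex \<Rightarrow> complex) set" where
  "admissible = {P. P holomorphic_on \<U> \<and> P 0 = 1 \<and> (\<forall>z\<in>\<U>. P z \<noteq> 0)}"

end

theory Submission
  imports Defs
begin

text \<open>
  Let \<open>P\<close> satisfy the differential subordination, let \<open>L\<close> be its logarithm with \<open>L 0 = 0\<close>, and put
  \<open>M = L / c\<close>. The hypothesis becomes \<open>Re (z M') > - 1 / 2\<close>, and then \<open>W = 1 - exp (- M)\<close> maps the
  disc into itself: at a point where \<open>\<bar>W\<bar>\<close> first reaches 1, Jack's lemma gives \<open>z W' = k W\<close> with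
  \<open>k \<ge> 1\<close>, so \<open>z M' = k W / (1 - W)\<close> has real part \<open>- k / 2 \<le> - 1 / 2\<close>. Hence
  \<open>P = exp (c M) = (1 - W) powr (- c) \<prec> q\<close>. The condition \<open>c \<in> set_B\<close> gives
  \<open>\<bar>Re (1 / c)\<bar> \<ge> 1 / 2\<close>, whence \<open>q\<close> is univalent: the logarithm maps \<open>1 - z\<close> into the strip
  \<open>\<bar>Im w\<bar> < pi / 2\<close>, which contains no two points differing by a nonzero multiple of \<open>2 pi \<i> / c\<close>.
  The dominant \<open>q\<close> is best because it satisfies the differential subordination itself, with equality.
\<close>

section \<open>Jack's lemma and the bound on \<open>1 - exp (- M)\<close>\<close>

text \<open>Take \<open>z0\<close> of least modulus with \<open>\<bar>W z0\<bar> \<ge> 1\<close>. Along the circle through \<open>z0\<close> the modulus of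
  \<open>W\<close> is maximal at \<open>z0\<close>, so \<open>z0 W' / W\<close> is real; along the radius the Schwarz lemma bounds
  \<open>\<bar>W (t z0)\<bar>\<close> by \<open>t\<close>, so it is at least 1.\<close>

lemma jack_lemma:
  assumes hol: "W holomorphic_on \<U>" and W0: "W 0 = 0" and z: "z \<in> \<U>" "norm (W z) \<ge> 1"
  obtains z0 and k :: real where "z0 \<in> \<U>" "k \<ge> 1" "norm (W z0) = 1"
    "z0 * deriv W z0 = of_real k * W z0"
proof -
  define S where "S = cball 0 (norm z) \<inter> (\<lambda>w. norm (W w)) -` {1..}"
  have sub: "cball 0 (norm z) \<subseteq> \<U>"
    using z by auto
  have cont: "continuous_on \<U> W"
    using hol by (rule holomorphic_on_imp_continuous_on)
  have "closed S"
    unfolding S_def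
    by (intro continuous_closed_preimage continuous_on_norm continuous_on_subset[OF cont sub]) auto
  moreover have "bounded S"
    unfolding S_def by (rule bounded_subset[OF bounded_cball]) auto
  ultimately have "compact S"
    by (simp add: compact_eq_bounded_closed)
  moreover have "z \<in> S"
    using z by (auto simp: S_def)
  ultimately obtain z0 where z0: "z0 \<in> S" and min: "\<And>w. w \<in> S \<Longrightarrow> norm z0 \<le> norm w"
    using continuous_attains_inf[of S norm] continuous_on_norm_id by blast
  define r where "r = norm z0"
  have z0U: "z0 \<in> \<U>" and ge: "norm (W z0) \<ge> 1"
    using z0 sub by (auto simp: S_def)
  have "z0 \<noteq> 0"
    using ge W0 by auto
  then have r: "0 < r" "r < 1"
    using z0U by (auto simp: r_def)
  have inside: "norm (W w) < 1" if "norm w < r" for w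
  proof (rule ccontr)
    assume "\<not> ?thesis"
    then have "w \<in> S"
      using that z0 by (auto simp: S_def r_def)
    then show False
      using min[of w] that by (simp add: r_def)
  qed
  have cle: "norm (W w) \<le> 1" if "norm w \<le> r" for w
  proof (rule continuous_on_closure_norm_le[where f = W and s = "ball 0 r" and x = w])
    show "continuous_on (closure (ball 0 r)) W"
      using r by (intro continuous_on_subset[OF cont]) auto
    show "\<forall>y\<in>ball 0 r. norm (W y) \<le> 1"
      using inside by (auto intro: less_imp_le)
    show "w \<in> closure (ball 0 r)"
      using r that by simp
  qed
  have W1: "norm (W z0) = 1"
    using cle[of z0] ge by (simp add: r_def)
  then have Wnz: "W z0 \<noteq> 0"
    by auto
  \<comment> \<open>The disc of radius \<open>r\<close> is rescaled to the unit disc, so that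
    minimality of \<open>norm z0\<close> supplies the hypothesis of the Schwarz lemma.\<close>
  have schwarz: "norm (W (z0 * u)) \<le> norm u" if "norm u < 1" for u
  proof (rule Schwarz_Lemma(1)[where f = "\<lambda>u. W (z0 * u)"])
    have *: "norm (z0 * u) < r" if "norm u < 1" for u
      using that r by (simp add: norm_mult r_def)
    show "(\<lambda>u. W (z0 * u)) holomorphic_on \<U>"
      by (rule holomorphic_on_compose_gen[OF _ hol, of "\<lambda>u. z0 * u", unfolded o_def])
        (use * r in \<open>force intro!: holomorphic_intros\<close>)+
    show "norm (W (z0 * u)) < 1" if "norm u < 1" for u
      using inside *[OF that] by blast
  qed (use W0 that in auto)
  define k where "k = z0 * deriv W z0 / W z0"
  \<comment> \<open>In the exponential coordinate, imaginary \<open>s\<close> runs along the circle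
    through \<open>z0\<close> and negative real \<open>s\<close> along the radius towards 0; the
    derivative at 0 is \<open>k\<close> in every direction.\<close>
  define G where "G s = W (z0 * exp s) / W z0" for s
  have dG: "(G has_field_derivative k) (at 0)"
  proof -
    have "((\<lambda>s. z0 * exp s) has_field_derivative z0) (at 0)"
      by (auto intro!: derivative_eq_intros)
    moreover have "(W has_field_derivative deriv W z0) (at (z0 * exp 0))"
      using holomorphic_derivI[OF hol open_ball z0U] by simp
    ultimately have "((\<lambda>s. W (z0 * exp s)) has_field_derivative deriv W z0 * z0) (at 0)"
      by (intro DERIV_chain2)
    from DERIV_cdivide[OF this, of "W z0"] show ?thesis
      by (simp add: G_def[abs_def] k_def mult.commute)
  qed
  have lineD: "((\<lambda>t. Re (G (of_real t * u))) has_real_derivative Re (u * k)) (at 0)" for u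
  proof -
    have "((\<lambda>w. w * u) has_field_derivative u) (at 0)"
      by (auto intro!: derivative_eq_intros)
    with dG have "((\<lambda>w. G (w * u)) has_field_derivative k * u) (at (of_real 0))"
      by (intro DERIV_chain2) auto
    then show ?thesis
      unfolding mult.commute[of u]
      by (intro has_field_derivative_Re has_vector_derivative_real_field)
  qed
  have G0: "G 0 = 1"
    using Wnz by (simp add: G_def)
  have "Re (\<i> * k) = 0"
  proof (rule DERIV_local_max[OF lineD zero_less_one])
    show "\<forall>y. \<bar>0 - y\<bar> < 1 \<longrightarrow> Re (G (of_real y * \<i>)) \<le> Re (G (of_real 0 * \<i>))"
    proof (intro allI impI)
      fix y :: real
      have "norm (G (of_real y * \<i>)) \<le> 1"
        using cle[of "z0 * exp (of_real y * \<i>)"] W1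
        by (simp add: G_def norm_divide norm_mult r_def)
      then show "Re (G (of_real y * \<i>)) \<le> Re (G (of_real 0 * \<i>))"
        using complex_Re_le_cmod[of "G (of_real y * \<i>)"] G0 by simp
    qed
  qed
  then have imk: "Im k = 0"
    by simp
  have rek: "Re k \<ge> 1"
  proof (rule ccontr)
    assume "\<not> ?thesis"
    \<comment> \<open>If \<open>Re k < 1\<close>, then \<open>Re (G (- h)) - exp (- h)\<close>,
      which is 0 at \<open>h = 0\<close>, has positive derivative there; for small
      \<open>h > 0\<close> this contradicts the Schwarz bound
      \<open>norm (G (- h)) \<le> exp (- h)\<close>.\<close>
    then have l: "0 < Re (-1 * k) - (- 1)"
      by simp
    have "((\<lambda>t. exp (- t)) has_real_derivative - 1) (at 0)"
      by (auto intro!: derivative_eq_intros)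
    from DERIV_pos_inc_right[OF DERIV_diff[OF lineD this] l]
    obtain d where d: "d > 0"
      "\<And>h. 0 < h \<Longrightarrow> h < d \<Longrightarrow> Re (G 0) - 1 < Re (G (of_real h * (-1))) - exp (-h)"
      by auto
    define h where "h = d / 2"
    have h: "0 < h" "h < d"
      using d by (auto simp: h_def)
    have "norm (G (of_real h * (-1))) \<le> exp (-h)"
      using schwarz[of "exp (of_real (-h))"] h W1
      by (simp add: G_def norm_divide)
    then show False
      using d(2)[OF h] complex_Re_le_cmod[of "G (of_real h * (-1))"] G0 by simp
  qed
  have "of_real (Re k) = k"
    using imk by (simp add: complex_eq_iff)
  then have "z0 * deriv W z0 = of_real (Re k) * W z0"
    using Wnz by (simp add: k_def)
  then show ?thesis
    using that[of z0 "Re k"] z0U rek W1 by blast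
qed

text \<open>Otherwise Jack's lemma gives a point where \<open>e = exp (- M z0)\<close> satisfies
  \<open>norm (1 - e) = 1\<close> and \<open>z0 * deriv M z0 = k * (1 - e) / e\<close>. The circle
  around 1 through 0 is sent by inversion to the line of real part 1/2, so
  \<open>Re ((1 - e) / e) = - 1 / 2\<close>, and \<open>k \<ge> 1\<close> contradicts the
  hypothesis.\<close>

lemma norm_one_minus_exp_less_1:
  assumes hol: "M holomorphic_on \<U>" and M0: "M 0 = 0"
    and re: "\<And>z. z \<in> \<U> \<Longrightarrow> Re (z * deriv M z) > - 1 / 2"
    and z: "z \<in> \<U>"
  shows "norm (1 - exp (- M z)) < 1"
proof (rule ccontr)
  define W where "W z = 1 - exp (- M z)" for z
  assume "\<not> ?thesis"
  moreover have "W holomorphic_on \<U>"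
    unfolding W_def by (intro holomorphic_intros hol)
  ultimately obtain z0 and k :: real where z0: "z0 \<in> \<U>" "k \<ge> 1" "norm (W z0) = 1"
    "z0 * deriv W z0 = of_real k * W z0"
    using jack_lemma[of W z] z M0 by (auto simp: W_def)
  define e where "e = exp (- M z0)"
  have "(W has_field_derivative e * deriv M z0) (at z0)"
    unfolding W_def e_def
    by (rule derivative_eq_intros holomorphic_derivI[OF hol] | use z0 in simp)+
  then have "deriv W z0 = e * deriv M z0"
    by (rule DERIV_imp_deriv)
  then have "z0 * deriv M z0 = of_real k * ((1 - e) / e)"
    using z0(4) by (simp add: W_def e_def field_simps)
  moreover have "Re ((1 - e) / e) = - 1 / 2"
  proof -
    have "(1 - Re e)\<^sup>2 + (Im e)\<^sup>2 = 1"
      using z0(3) by (simp add: W_def e_def[symmetric] cmod_def)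
    moreover have "(Re e)\<^sup>2 + (Im e)\<^sup>2 > 0"
      unfolding complex_neq_0[symmetric] by (simp add: e_def)
    ultimately show ?thesis
      by (simp add: Re_divide divide_simps) (simp add: algebra_simps power2_eq_square)
  qed
  ultimately have "Re (z0 * deriv M z0) = k * (- 1 / 2)"
    by (simp only: times_complex.sel(1)[of "of_real k"] Re_complex_of_real Im_complex_of_real mult_zero_left diff_zero)
  then show False
    using re[OF z0(1)] z0(2) by simp
qed

section \<open>Subordination to a half-plane map and to a power of \<open>1 - z\<close>\<close>

lemma subordinate_transform:
  fixes g h :: "complex \<Rightarrow> complex"
  assumes "g \<prec> h" and "\<And>z. z \<in> \<U> \<Longrightarrow> g z = g' z"
  shows "g' \<prec> h"
  using assms holomorphic_transform[of g \<U> g'] unfolding subordinate_def by metis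

text \<open>The right-hand function is the Moebius map of the disc onto the half-plane
  \<open>Re w > \<alpha>\<close> that sends 0 to 1. Composing \<open>g\<close> with its inverse
  gives the Schwarz function \<open>(g - 1) / (g + 1 - 2 * \<alpha>)\<close>.\<close>

lemma subordinate_half_plane_iff:
  fixes \<alpha> :: real
  assumes "\<alpha> < 1"
  shows "g \<prec> (\<lambda>z. (1 + (1 - 2 * complex_of_real \<alpha>) * z) / (1 - z)) \<longleftrightarrow>
    g holomorphic_on \<U> \<and> g 0 = 1 \<and> (\<forall>z\<in>\<U>. Re (g z) > \<alpha>)"
proof -
  let ?h = "\<lambda>z. (1 + (1 - 2 * complex_of_real \<alpha>) * z) / (1 - z)"
  show ?thesis
  proof safe
    assume "g \<prec> ?h"
    then obtain \<omega> where om: "g holomorphic_on \<U>" "\<omega> ` \<U> \<subseteq> \<U>" "\<omega> 0 = 0" "\<forall>z\<in>\<U>. g z = ?h (\<omega> z)"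
      unfolding subordinate_def by blast
    then show "g holomorphic_on \<U>" "g 0 = 1"
      by auto
    fix z :: complex assume z: "z \<in> \<U>"
    define w where "w = \<omega> z"
    have w: "norm w < 1"
      using om(2) z unfolding w_def by (metis image_subset_iff mem_ball_0)
    then have w1: "w \<noteq> 1"
      by auto
    have eq: "?h w = of_real \<alpha> + of_real (1 - \<alpha>) * ((1 + w) / (1 - w))"
      using w1 by (simp add: field_simps)
    have "Re ((1 + w) / (1 - w)) > 0"
    proof -
      have "(Re w)\<^sup>2 + (Im w)\<^sup>2 < 1"
        using w by (simp add: cmod_def)
      moreover have "(1 - Re w)\<^sup>2 + (Im w)\<^sup>2 > 0"
        using w1 by (simp add: sum_power2_gt_zero_iff complex_eq_iff)
      ultimately show ?thesis
        by (simp add: Re_divide divide_simps) (simp add: algebra_simps power2_eq_square)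
    qed
    then have "Re (?h w) > \<alpha>"
      unfolding eq plus_complex.sel(1) times_complex.sel(1)[of "of_real _"] using assms by simp
    then show "Re (g z) > \<alpha>"
      using om(4) z by (simp add: w_def)
  next
    assume hol: "g holomorphic_on \<U>" and g0: "g 0 = 1" and re: "\<forall>z\<in>\<U>. Re (g z) > \<alpha>"
    define \<omega> where "\<omega> z = (g z - 1) / (g z + 1 - 2 * of_real \<alpha>)" for z
    have nz: "g z + 1 - 2 * of_real \<alpha> \<noteq> 0" if "z \<in> \<U>" for z
    proof
      assume "g z + 1 - 2 * of_real \<alpha> = 0"
      then have "Re (g z + 1 - 2 * of_real \<alpha>) = 0"
        by simp
      then show False
        using re[rule_format, OF that] assms by simp
    qed
    have "norm (\<omega> z) < 1" if "z \<in> \<U>" for z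
    proof -
      \<comment> \<open>Four times this product is the difference of the two squared moduli compared
        next.\<close>
      have "0 < (1 - \<alpha>) * (Re (g z) - \<alpha>)"
        using re that assms by simp
      then have "(norm (g z - 1))\<^sup>2 < (norm (g z + 1 - 2 * of_real \<alpha>))\<^sup>2"
        unfolding cmod_power2 by (simp add: algebra_simps power2_eq_square)
      then have "norm (g z - 1) < norm (g z + 1 - 2 * of_real \<alpha>)"
        by (rule power_less_imp_less_base) simp
      then show ?thesis
        using nz[OF that] by (simp add: \<omega>_def norm_divide)
    qed
    moreover have "\<omega> holomorphic_on \<U>"
      unfolding \<omega>_def using nz by (intro holomorphic_intros hol) auto
    moreover have "g z = ?h (\<omega> z)" if "z \<in> \<U>" for z
    proof -
      define d where "d = g z + 1 - 2 * of_real \<alpha>"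
      have d: "d \<noteq> 0" "g z = d - 1 + 2 * of_real \<alpha>"
        using nz[OF that] by (auto simp: d_def)
      have "complex_of_real \<alpha> \<noteq> 1"
        using assms by (simp add: of_real_eq_1_iff)
      then show ?thesis
        using d(1) unfolding \<omega>_def d_def[symmetric] unfolding d(2)
        by (simp add: divide_simps) (simp add: algebra_simps)
    qed
    moreover have "?h holomorphic_on \<U>"
      by (intro holomorphic_intros) auto
    moreover have "\<omega> 0 = 0"
      using g0 by (simp add: \<omega>_def)
    ultimately show "g \<prec> ?h"
      unfolding subordinate_def using hol
      by (intro conjI exI[of _ \<omega>]) (simp_all add: image_subset_iff)
  qed
qed

text \<open>With \<open>P = exp L\<close> and \<open>M = L / c\<close>, the hypothesis reads
  \<open>Re (z * deriv M z) > - 1 / 2\<close>, so \<open>W = 1 - exp (- M)\<close> is a Schwarz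
  function; it is the one realizing the subordination.\<close>

lemma subordinate_one_minus_powr:
  assumes P: "P \<in> admissible" and c: "c \<noteq> 0"
    and re: "\<And>z. z \<in> \<U> \<Longrightarrow> Re (z * deriv P z / (c * P z)) > - 1 / 2"
  shows "P \<prec> (\<lambda>z. (1 - z) powr (- c))"
proof -
  have holP: "P holomorphic_on \<U>" and P0: "P 0 = 1" and Pnz: "\<And>z. z \<in> \<U> \<Longrightarrow> P z \<noteq> 0"
    using P by (auto simp: admissible_def)
  obtain L where L: "L holomorphic_on \<U>" "L 0 = 0" "\<And>z. z \<in> \<U> \<Longrightarrow> exp (L z) = P z"
    using is_disc_log_exists[OF holP Pnz P0] by (auto simp: is_disc_log_def)
  define M where "M z = L z / c" for z
  define W where "W z = 1 - exp (- M z)" for z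
  have holM: "M holomorphic_on \<U>"
    unfolding M_def by (intro holomorphic_intros L c)
  have holW: "W holomorphic_on \<U>"
    unfolding W_def by (intro holomorphic_intros holM)
  have dM: "deriv M z = deriv P z / (c * P z)" if z: "z \<in> \<U>" for z
  proof -
    have "((\<lambda>z. exp (L z)) has_field_derivative P z * deriv L z) (at z)"
      by (rule derivative_eq_intros holomorphic_derivI[OF L(1)] | use z L in simp)+
    then have "(P has_field_derivative P z * deriv L z) (at z)"
      by (rule has_field_derivative_transform_within_open[where S = \<U>]) (use z L in auto)
    then have "deriv P z = P z * deriv L z"
      by (rule DERIV_imp_deriv)
    moreover have "(M has_field_derivative deriv L z / c) (at z)"
      unfolding M_def
      by (rule derivative_eq_intros holomorphic_derivI[OF L(1)] | use z c in simp)+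
    then have "deriv M z = deriv L z / c"
      by (rule DERIV_imp_deriv)
    ultimately show ?thesis
      using Pnz[OF z] by simp
  qed
  have W: "norm (W z) < 1" if "z \<in> \<U>" for z
    unfolding W_def
    by (rule norm_one_minus_exp_less_1[OF holM _ _ that])
      (use re dM L in \<open>auto simp: M_def\<close>)
  have Re1: "Re (1 - W z) > 0" if "z \<in> \<U>" for z
    using W[OF that] complex_Re_le_cmod[of "W z"] by simp
  \<comment> \<open>Both \<open>- M\<close> and \<open>Ln (1 - W)\<close> are logarithms of
    \<open>1 - W\<close> vanishing at 0, the latter being holomorphic because \<open>1 - W\<close>
    stays in the right half-plane. Uniqueness gives \<open>L = - c * Ln (1 - W)\<close>, which turns
    \<open>exp L\<close> into a principal power.\<close>
  have log1: "is_disc_log (\<lambda>z. 1 - W z) (\<lambda>z. - M z)"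
    unfolding is_disc_log_def using holM L by (auto intro!: holomorphic_intros simp: W_def M_def)
  have log2: "is_disc_log (\<lambda>z. 1 - W z) (\<lambda>z. Ln (1 - W z))"
    unfolding is_disc_log_def
  proof (intro conjI ballI)
    show "(\<lambda>z. Ln (1 - W z)) holomorphic_on \<U>"
      using Re1 by (intro holomorphic_intros holW) (force simp: complex_nonpos_Reals_iff)
    show "Ln (1 - W 0) = 0"
      using L by (simp add: W_def M_def)
    show "exp (Ln (1 - W z)) = 1 - W z" for z
      by (rule exp_Ln) (simp add: W_def)
  qed
  have "P z = (1 - W z) powr (- c)" if z: "z \<in> \<U>" for z
  proof -
    have "1 - W z \<noteq> 0"
      by (simp add: W_def)
    moreover have "L z = - c * Ln (1 - W z)"
      unfolding is_disc_log_unique[OF log1 log2 z, symmetric] using c by (simp add: M_def)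
    ultimately show ?thesis
      using L(3)[OF z] by (simp add: powr_def)
  qed
  moreover have "W 0 = 0"
    using L by (simp add: W_def M_def)
  moreover have "(\<lambda>z. (1 - z) powr (- c)) holomorphic_on \<U>"
    by (rule holomorphic_intros)+ (auto simp: complex_nonpos_Reals_iff dest: order.strict_trans1[OF complex_Re_le_cmod])
  ultimately show ?thesis
    unfolding subordinate_def using holP holW W
    by (intro conjI exI[of _ W]) auto
qed

section \<open>Univalence of the dominant\<close>

lemma univalent_one_minus_powr:
  assumes "c \<in> set_B" and "c \<noteq> 0"
  shows "univalent (\<lambda>z. (1 - z) powr (- c))"
  unfolding univalent_def
proof
  have pos: "Re (1 - z) > 0" if "z \<in> \<U>" for z
    using that complex_Re_le_cmod[of z] by simp
  show "(\<lambda>z. (1 - z) powr (- c)) holomorphic_on \<U>"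
    using pos by (intro holomorphic_intros) (force simp: complex_nonpos_Reals_iff)
  \<comment> \<open>Either disc condition in \<open>set_B\<close> expands to
    \<open>norm c ^ 2 \<le> 2 * \<bar>Re c\<bar>\<close>; division by \<open>norm c ^ 2\<close>
    gives the bound.\<close>
  have c: "\<bar>Re (1 / c)\<bar> \<ge> 1 / 2"
  proof -
    have "(Re c)\<^sup>2 + (Im c)\<^sup>2 \<le> 2 * \<bar>Re c\<bar>"
      using assms(1) unfolding set_B_def cmod_def
      by (auto simp: power2_eq_square algebra_simps)
    moreover have "(Re c)\<^sup>2 + (Im c)\<^sup>2 > 0"
      using assms(2) complex_neq_0 by blast
    ultimately show ?thesis
      by (simp add: Re_divide divide_simps)
  qed
  show "inj_on (\<lambda>z. (1 - z) powr (- c)) \<U>"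
  proof (rule inj_onI)
    fix x y assume x: "x \<in> \<U>" and y: "y \<in> \<U>" and eq: "(1 - x) powr (- c) = (1 - y) powr (- c)"
    have nz: "1 - x \<noteq> 0" "1 - y \<noteq> 0"
      using pos[OF x] pos[OF y] by (metis less_irrefl zero_complex.simps(1))+
    define D where "D = Ln (1 - x) - Ln (1 - y)"
    have "exp (- c * Ln (1 - x)) = exp (- c * Ln (1 - y))"
      using eq nz by (simp add: powr_def)
    then obtain n :: int where n: "- c * Ln (1 - x) = - c * Ln (1 - y) + (of_int (2 * n) * pi) * \<i>"
      unfolding exp_eq by blast
    \<comment> \<open>Equal powers force the logarithms to differ by an integer multiple of
      \<open>2 * pi * \<i> / c\<close>. The imaginary part of this difference is at least
      \<open>\<bar>n\<bar> * pi\<close> in modulus, yet below \<open>pi\<close>, so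
      \<open>n = 0\<close>.\<close>
    have D: "D = of_real (- 2 * of_int n * pi) * (\<i> * (1 / c))"
      using n assms(2) by (simp add: D_def field_simps)
    have "Im D = (- 2 * of_int n * pi) * Re (1 / c)"
      unfolding D times_complex.sel imaginary_unit.sel Re_complex_of_real Im_complex_of_real by simp
    then have "\<bar>Im D\<bar> = 2 * \<bar>of_int n\<bar> * pi * \<bar>Re (1 / c)\<bar>"
      by (simp add: abs_mult)
    moreover have "\<bar>Im D\<bar> < pi"
      using Re_Ln_pos_lt_imp[OF pos[OF x]] Re_Ln_pos_lt_imp[OF pos[OF y]] by (simp add: D_def)
    moreover have "2 * \<bar>of_int n\<bar> * pi * \<bar>Re (1 / c)\<bar> \<ge> 2 * \<bar>of_int n\<bar> * pi * (1 / 2)"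
      by (intro mult_left_mono c) auto
    ultimately have "\<bar>real_of_int n\<bar> * pi < 1 * pi"
      by linarith
    then have "\<bar>real_of_int n\<bar> < 1"
      by (rule mult_right_less_imp_less) simp
    then have "n = 0"
      by linarith
    then have "Ln (1 - x) = Ln (1 - y)"
      using D by (simp add: D_def)
    then have "1 - x = 1 - y"
      using nz by (metis exp_Ln)
    then show "x = y"
      by simp
  qed
qed

section \<open>The normalized derivative and the class \<open>class_K\<close>\<close>

text \<open>Dividing the series of \<open>f z - z ^ p\<close> by \<open>z ^ (p + 1)\<close> leaves a
  power series convergent on the disc; with sum \<open>S\<close>, the factor is
  \<open>H z = 1 + z * S z\<close>.\<close>

lemma class_A_factor:
  assumes "f \<in> class_A p"
  obtains H where "H holomorphic_on \<U>" "H 0 = 1" "\<And>z. z \<in> \<U> \<Longrightarrow> f z = z ^ p * H z"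
proof -
  obtain a where a: "\<And>z. z \<in> \<U> \<Longrightarrow> (\<lambda>k. a (p + 1 + k) * z ^ (p + 1 + k)) sums (f z - z ^ p)"
    using assms unfolding class_A_def by blast
  define S where "S z = (if z = 0 then a (p + 1) else (f z - z ^ p) / z ^ (p + 1))" for z
  have "(\<lambda>k. a (p + 1 + k) * (z - 0) ^ k) sums S z" if "z \<in> \<U>" for z
  proof (cases "z = 0")
    case True
    then show ?thesis
      using powser_sums_zero[of "\<lambda>k. a (p + 1 + k)"] by (simp add: S_def)
  next
    case False
    have "(\<lambda>k. z ^ (p + 1) * (a (p + 1 + k) * z ^ k)) sums (f z - z ^ p)"
      using a[OF that] by (simp only: power_add mult.commute mult.left_commute)
    from sums_mult_D[OF this] show ?thesis
      using False by (simp add: S_def)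
  qed
  then have "S holomorphic_on \<U>"
    by (rule power_series_holomorphic)
  then have "(\<lambda>z. 1 + z * S z) holomorphic_on \<U>"
    by (intro holomorphic_intros)
  moreover have "f z = z ^ p * (1 + z * S z)" if "z \<in> \<U>" for z
  proof (cases "z = 0")
    case True
    \<comment> \<open>All exponents are at least 1, so every term vanishes at 0.\<close>
    have "(\<lambda>k. 0) sums (f z - z ^ p)"
      using a[OF that] True by simp
    then have "f z - z ^ p = 0"
      using sums_unique2 sums_zero by blast
    then show ?thesis
      using True by simp
  next
    case False
    then show ?thesis
      by (simp add: S_def field_simps)
  qed
  ultimately show ?thesis
    using that[of "\<lambda>z. 1 + z * S z"] by simp
qed

text \<open>Writing \<open>f = z ^ p * H\<close> turns the quotient into
  \<open>H + z * H' / p\<close>, which is holomorphic across 0 and takes there the prescribed value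
  \<open>H 0 = 1\<close>.\<close>

lemma normalized_deriv_holomorphic:
  assumes f: "f \<in> class_A p" and p: "p \<ge> 1"
  shows "normalized_deriv p f holomorphic_on \<U>"
proof -
  obtain H where H: "H holomorphic_on \<U>" "H 0 = 1" "\<And>z. z \<in> \<U> \<Longrightarrow> f z = z ^ p * H z"
    using class_A_factor[OF f] by metis
  obtain m where m: "p = Suc m"
    using p by (cases p) auto
  have "(\<lambda>z. H z + z * deriv H z / of_nat p) holomorphic_on \<U>"
    using p by (intro holomorphic_intros holomorphic_deriv H) auto
  moreover have "H z + z * deriv H z / of_nat p = normalized_deriv p f z" if z: "z \<in> \<U>" for z
  proof (cases "z = 0")
    case True
    then show ?thesis
      by (simp add: normalized_deriv_def H)
  next
    case False
    have "((\<lambda>z. z ^ p * H z) has_field_derivative (of_nat p * z ^ m * H z + z ^ p * deriv H z)) (at z)"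
      using DERIV_mult[OF DERIV_power[OF DERIV_ident, of p] holomorphic_derivI[OF H(1) open_ball z]]
      by (simp add: m mult.commute del: of_nat_Suc power_Suc)
    then have "(f has_field_derivative (of_nat p * z ^ m * H z + z ^ p * deriv H z)) (at z)"
      by (rule has_field_derivative_transform_within_open[where S = \<U>]) (use H z in auto)
    then have "deriv f z = of_nat p * z ^ m * H z + z ^ p * deriv H z"
      by (rule DERIV_imp_deriv)
    moreover have "complex_of_nat p \<noteq> 0"
      using p by simp
    ultimately show ?thesis
      using False by (simp add: normalized_deriv_def m field_simps del: of_nat_Suc)
  qed
  ultimately show ?thesis
    by (rule holomorphic_transform)
qed

text \<open>Logarithmic differentiation of \<open>f' = p * z ^ (p - 1) * G\<close>: the power of
  \<open>z\<close> contributes \<open>p - 1\<close>, the value prescribed at 0.\<close>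

lemma zf2_over_f1_eq:
  assumes f: "f \<in> class_A p" and p: "p \<ge> 1" and z: "z \<in> \<U>"
    and nz: "normalized_deriv p f z \<noteq> 0"
  shows "zf2_over_f1 p f z =
    of_nat p - 1 + z * deriv (normalized_deriv p f) z / normalized_deriv p f z"
proof (cases "z = 0")
  case True
  then show ?thesis
    by (simp add: zf2_over_f1_def)
next
  case False
  define G where "G = normalized_deriv p f"
  obtain m where m: "p = Suc m"
    using p by (cases p) auto
  have p0: "complex_of_nat p \<noteq> 0"
    using p by simp
  have f1: "deriv f w = of_nat p * w ^ m * G w" if "w \<noteq> 0" for w
    using that p0 by (simp add: G_def normalized_deriv_def m del: of_nat_Suc)
  \<comment> \<open>For \<open>m = 0\<close> the exponent \<open>m - 1\<close> is truncated to 0,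
    but the factor \<open>of_nat m\<close> makes both sides 0.\<close>
  have zm: "z * (of_nat m * z ^ (m - 1)) = of_nat m * z ^ m"
    by (cases m) auto
  have "((\<lambda>w. of_nat p * w ^ m * G w) has_field_derivative
      (of_nat p * (of_nat m * z ^ (m - 1)) * G z + of_nat p * z ^ m * deriv G z)) (at z)"
    using normalized_deriv_holomorphic[OF f p] z
    by (auto intro!: derivative_eq_intros holomorphic_derivI[where S = \<U>] simp: G_def)
  then have "(deriv f has_field_derivative
      (of_nat p * (of_nat m * z ^ (m - 1)) * G z + of_nat p * z ^ m * deriv G z)) (at z)"
    by (rule has_field_derivative_transform_within_open[where S = "- {0}"]) (use f1 False in auto)
  then have "deriv (deriv f) z =
      of_nat p * (of_nat m * z ^ (m - 1)) * G z + of_nat p * z ^ m * deriv G z"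
    by (rule DERIV_imp_deriv)
  then have "z * deriv (deriv f) z =
      of_nat p * (z * (of_nat m * z ^ (m - 1))) * G z + z * (of_nat p * z ^ m * deriv G z)"
    by (simp add: algebra_simps)
  also have "\<dots> = of_nat p * z ^ m * (of_nat m * G z + z * deriv G z)"
    unfolding zm by (simp add: algebra_simps)
  finally have "zf2_over_f1 p f z = (of_nat m * G z + z * deriv G z) / G z"
    using False p0 by (simp add: zf2_over_f1_def f1)
  then show ?thesis
    using nz unfolding G_def[symmetric] by (simp add: m add_divide_distrib)
qed

text \<open>A zero of \<open>f'\<close> away from 0 would be a pole of \<open>z f'' / f'\<close>. Since division by zero gives 0, the
  holomorphy of \<open>zf2_over_f1 p f\<close> as a total function does not exclude such a zero outright; the
  equation below is therefore assumed only where \<open>G\<close> does not vanish, extended by the identity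
  theorem, and integrated.\<close>

lemma nonvanishing_of_log_deriv:
  assumes G: "G holomorphic_on \<U>" "G 0 = 1" and V: "V holomorphic_on \<U>" "V 0 = 0"
    and eq: "\<And>z. z \<in> \<U> \<Longrightarrow> G z \<noteq> 0 \<Longrightarrow> z * deriv G z = V z * G z"
    and z: "z \<in> \<U>"
  shows "G z \<noteq> 0"
proof -
  define v where "v z = (if z = 0 then deriv V 0 else V z / z)" for z
  have hv: "v holomorphic_on \<U>"
    using pole_lemma_open[OF V(1) open_ball, of 0] unfolding V(2) diff_zero v_def[abs_def] .
  define E where "E z = deriv G z - v z * G z" for z
  have hE: "E holomorphic_on \<U>"
    unfolding E_def by (intro holomorphic_intros holomorphic_deriv G hv open_ball)
  \<comment> \<open>On this neighbourhood of 0 the equation may be divided by \<open>z\<close>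
    except at 0 itself, so \<open>E\<close> vanishes on a set accumulating at 0, and hence on the
    whole disc.\<close>
  define T where "T = \<U> \<inter> G -` (- {0})"
  have "open T"
    unfolding T_def
    by (intro continuous_open_preimage holomorphic_on_imp_continuous_on[OF G(1)]) auto
  moreover have "0 \<in> T"
    using G(2) by (simp add: T_def)
  ultimately have "0 islimpt T - {0}"
    using interior_limit_point[of 0 T] islimpt_punctured by (metis interior_open)
  moreover have "E w = 0" if "w \<in> T - {0}" for w
    using eq[of w] that by (simp add: E_def T_def v_def field_simps)
  ultimately have E0: "E w = 0" if "w \<in> \<U>" for w
    using analytic_continuation[OF hE, of "T - {0}" 0] that by (auto simp: T_def)
  \<comment> \<open>\<open>exp (- A)\<close> is an integrating factor for \<open>G' = v * G\<close>,
    so \<open>G\<close> is a nonzero constant times \<open>exp A\<close>.\<close>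
  obtain A where A: "\<And>w. w \<in> \<U> \<Longrightarrow> (A has_field_derivative v w) (at w within \<U>)"
    using holomorphic_convex_primitive'[OF convex_ball open_ball hv] by blast
  have const: "((\<lambda>w. G w * exp (- A w)) has_field_derivative 0) (at w within \<U>)" if w: "w \<in> \<U>" for w
  proof -
    have "(A has_field_derivative v w) (at w)"
      using A[OF w] at_within_open[OF w open_ball] by simp
    moreover have "(G has_field_derivative v w * G w) (at w)"
      using holomorphic_derivI[OF G(1) open_ball w] E0[OF w] by (simp add: E_def)
    ultimately have "((\<lambda>w. G w * exp (- A w)) has_field_derivative
        v w * G w * exp (- A w) + exp (- A w) * - v w * G w) (at w)"
      by (intro DERIV_mult DERIV_chain2[OF DERIV_exp] DERIV_minus)
    then have "((\<lambda>w. G w * exp (- A w)) has_field_derivative 0) (at w)"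
      by (rule DERIV_cong) simp
    then show ?thesis
      by (rule has_field_derivative_at_within)
  qed
  obtain k where k: "\<And>w. w \<in> \<U> \<Longrightarrow> G w * exp (- A w) = k"
    using has_field_derivative_zero_constant[OF convex_ball const] by blast
  have "G z * exp (- A z) = exp (- A 0)"
    using k[OF z] k[of 0] G(2) by simp
  then show ?thesis
    by (metis exp_not_eq_zero mult_zero_left)
qed

text \<open>Euler's formula identifies the expression in \<open>class_K\<close> with the
  subordinated function, and the half-plane criterion does the rest. The delicate point is to
  recover \<open>f' \<noteq> 0\<close> from the holomorphy of that function.\<close>

lemma class_K_iff_subordinate:
  fixes p :: nat and b :: complex and \<alpha> lam :: real
  assumes f: "f \<in> class_A p" and p: "p \<ge> 1" and b: "b \<noteq> 0" and \<alpha>: "\<alpha> < 1" and cos: "cos lam \<noteq> 0"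
  shows "f \<in> class_K p lam \<alpha> b \<longleftrightarrow>
    (\<lambda>z. 1 + exp (\<i> * complex_of_real lam) / (b * complex_of_real (cos lam))
           * (1 / of_nat p * (1 + zf2_over_f1 p f z) - 1))
      \<prec> (\<lambda>z. (1 + (1 - 2 * complex_of_real \<alpha>) * z) / (1 - z))"
proof -
  define k where "k = exp (\<i> * complex_of_real lam) / (b * complex_of_real (cos lam))"
  define \<Psi> where "\<Psi> z = 1 + k * (1 / of_nat p * (1 + zf2_over_f1 p f z) - 1)" for z
  define G where "G = normalized_deriv p f"
  have p0: "complex_of_nat p \<noteq> 0"
    using p by simp
  have k0: "k \<noteq> 0"
    using b cos by (simp add: k_def)
  have hG: "G holomorphic_on \<U>" and G0: "G 0 = 1"
    using normalized_deriv_holomorphic[OF f p] by (simp_all add: G_def normalized_deriv_def)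
  have Gf: "G z \<noteq> 0 \<longleftrightarrow> deriv f z \<noteq> 0" if "z \<noteq> 0" for z
    using that p0 by (simp add: G_def normalized_deriv_def)
  have \<Psi>0: "\<Psi> 0 = 1"
    using p0 by (simp add: \<Psi>_def zf2_over_f1_def)
  have zf2: "zf2_over_f1 p f z = of_nat p - 1 + z * deriv G z / G z"
    if "z \<in> \<U>" "G z \<noteq> 0" for z
    using zf2_over_f1_eq[OF f p] that by (simp add: G_def)
  have expr: "1 / (b * complex_of_real (cos lam)) *
        (exp (\<i> * complex_of_real lam) / of_nat p * (1 + zf2_over_f1 p f z)
         - (1 - b) * complex_of_real (cos lam) - \<i> * complex_of_real (sin lam)) = \<Psi> z" for z
  proof -
    have "(1 - b) * complex_of_real (cos lam) + \<i> * complex_of_real (sin lam) =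
        exp (\<i> * complex_of_real lam) - b * complex_of_real (cos lam)"
      by (simp add: exp_Euler algebra_simps flip: cos_of_real sin_of_real)
    then have "exp (\<i> * complex_of_real lam) / of_nat p * (1 + zf2_over_f1 p f z)
         - (1 - b) * complex_of_real (cos lam) - \<i> * complex_of_real (sin lam) =
        exp (\<i> * complex_of_real lam) * (1 / of_nat p * (1 + zf2_over_f1 p f z) - 1)
         + b * complex_of_real (cos lam)"
      unfolding diff_diff_eq by (simp add: right_diff_distrib)
    then show ?thesis
      using b cos by (simp add: \<Psi>_def k_def add_divide_distrib)
  qed
  have "f \<in> class_K p lam \<alpha> b \<longleftrightarrow>
      (\<forall>z\<in>\<U> - {0}. G z \<noteq> 0) \<and> (\<forall>z\<in>\<U>. Re (\<Psi> z) > \<alpha>)"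
    unfolding class_K_def mem_Collect_eq expr using f Gf by auto
  also have "\<dots> \<longleftrightarrow> \<Psi> holomorphic_on \<U> \<and> \<Psi> 0 = 1 \<and> (\<forall>z\<in>\<U>. Re (\<Psi> z) > \<alpha>)"
  proof (intro iffI conjI)
    assume "(\<forall>z\<in>\<U> - {0}. G z \<noteq> 0) \<and> (\<forall>z\<in>\<U>. Re (\<Psi> z) > \<alpha>)"
    then have nz: "G z \<noteq> 0" if "z \<in> \<U>" for z
      using that G0 by (cases "z = 0") auto
    have "(\<lambda>z. 1 + k * (1 / of_nat p * (1 + (of_nat p - 1 + z * deriv G z / G z)) - 1)) holomorphic_on \<U>"
      using nz p0 by (intro holomorphic_intros holomorphic_deriv hG) auto
    then show "\<Psi> holomorphic_on \<U>"
      by (rule holomorphic_transform) (use zf2 nz in \<open>simp add: \<Psi>_def\<close>)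
  next
    assume r: "\<Psi> holomorphic_on \<U> \<and> \<Psi> 0 = 1 \<and> (\<forall>z\<in>\<U>. Re (\<Psi> z) > \<alpha>)"
    \<comment> \<open>Solving the definition of \<open>\<Psi>\<close> for
      \<open>zf2_over_f1 p f z - (p - 1)\<close> gives a holomorphic function that agrees with
      \<open>z * G' / G\<close> wherever \<open>G\<close> is nonzero.\<close>
    define V where "V z = of_nat p * (\<Psi> z - 1) / k" for z
    have V: "V z = zf2_over_f1 p f z - (of_nat p - 1)" for z
      using k0 p0 by (simp add: V_def \<Psi>_def field_simps)
    have "V holomorphic_on \<U>"
      unfolding V_def using r k0 by (intro holomorphic_intros) auto
    moreover have "V 0 = 0"
      by (simp add: V_def \<Psi>0)
    moreover have "z * deriv G z = V z * G z" if "z \<in> \<U>" "G z \<noteq> 0" for z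
      using zf2[OF that] that(2) by (simp add: V)
    ultimately show "\<forall>z\<in>\<U> - {0}. G z \<noteq> 0"
      using nonvanishing_of_log_deriv[OF hG G0] by blast
  qed (use \<Psi>0 in auto)
  also have "\<dots> \<longleftrightarrow> \<Psi> \<prec> (\<lambda>z. (1 + (1 - 2 * complex_of_real \<alpha>) * z) / (1 - z))"
    using subordinate_half_plane_iff[OF \<alpha>] by simp
  finally show ?thesis
    unfolding \<Psi>_def k_def .
qed

section \<open>Powers of admissible functions and the best dominant\<close>

text \<open>The chosen logarithm \<open>L\<close> of \<open>G\<close> makes the power
  \<open>exp (a * L)\<close>, whose logarithmic derivative is \<open>a * L'\<close>.\<close>

lemma branch_power_admissible:
  assumes "G \<in> admissible"
  shows "branch_power G a \<in> admissible"
    and "z \<in> \<U> \<Longrightarrow> deriv (branch_power G a) z / branch_power G a z = a * (deriv G z / G z)"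
proof -
  have hG: "G holomorphic_on \<U>" and G0: "G 0 = 1" and Gnz: "\<And>z. z \<in> \<U> \<Longrightarrow> G z \<noteq> 0"
    using assms by (auto simp: admissible_def)
  define L where "L = (SOME L. is_disc_log G L)"
  have "is_disc_log G L"
    unfolding L_def using is_disc_log_exists[OF hG Gnz G0] by (rule someI_ex)
  then have L: "L holomorphic_on \<U>" "L 0 = 0" "\<And>z. z \<in> \<U> \<Longrightarrow> exp (L z) = G z"
    by (auto simp: is_disc_log_def)
  have bp: "branch_power G a = (\<lambda>z. exp (a * L z))"
    by (simp add: fun_eq_iff branch_power_def L_def)
  show "branch_power G a \<in> admissible"
    unfolding admissible_def bp using L by (auto intro!: holomorphic_intros)
  assume z: "z \<in> \<U>"
  note dL = holomorphic_derivI[OF L(1) open_ball z]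
  have "((\<lambda>z. exp (L z)) has_field_derivative exp (L z) * deriv L z) (at z)"
    by (rule DERIV_chain2[OF DERIV_exp dL])
  then have "(G has_field_derivative exp (L z) * deriv L z) (at z)"
    by (rule has_field_derivative_transform_within_open[where S = \<U>]) (use L z in auto)
  then have "deriv G z / G z = deriv L z"
    using L(3)[OF z] Gnz[OF z] by (simp add: DERIV_imp_deriv)
  moreover have "((\<lambda>z. exp (a * L z)) has_field_derivative exp (a * L z) * (a * deriv L z)) (at z)"
    by (rule DERIV_chain2[OF DERIV_exp DERIV_cmult[OF dL]])
  then have "deriv (branch_power G a) z = exp (a * L z) * (a * deriv L z)"
    unfolding bp by (rule DERIV_imp_deriv)
  ultimately show "deriv (branch_power G a) z / branch_power G a z = a * (deriv G z / G z)"
    by (simp add: bp)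
qed

text \<open>Since \<open>k * c = 2 * (1 - \<alpha>)\<close>, the condition
  \<open>Re (1 + k * z * P' / P) > \<alpha>\<close> is exactly
  \<open>Re (z * P' / (c * P)) > - 1 / 2\<close>. Moreover
  \<open>z * q' / q = c * z / (1 - z)\<close>, so \<open>q\<close> is itself an admissible solution
  and is subordinate to every dominant.\<close>

lemma best_dominant_one_minus_powr:
  fixes k c :: complex and \<alpha> :: real
  assumes \<alpha>: "\<alpha> < 1" and kc: "k * c = 2 * complex_of_real (1 - \<alpha>)" and B: "c \<in> set_B"
  shows "best_dominant admissible (\<lambda>r s z. 1 + k * (s / r))
    (\<lambda>z. (1 + (1 - 2 * complex_of_real \<alpha>) * z) / (1 - z)) (\<lambda>z. (1 - z) powr (- c))"
proof -
  let ?h = "\<lambda>z. (1 + (1 - 2 * complex_of_real \<alpha>) * z) / (1 - z)"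
  let ?q = "\<lambda>z. (1 - z) powr (- c)"
  \<comment> \<open>The set \<open>set_B\<close> contains 0; that value is excluded by
    \<open>kc\<close>, whose right-hand side is nonzero.\<close>
  have c: "c \<noteq> 0"
    using kc \<alpha> by auto
  have univ: "univalent ?q"
    by (rule univalent_one_minus_powr[OF B c])
  have dom: "dominant admissible (\<lambda>r s z. 1 + k * (s / r)) ?h ?q"
    unfolding dominant_def
  proof (intro ballI impI)
    fix P assume P: "P \<in> admissible" and sub: "(\<lambda>z. 1 + k * (z * deriv P z / P z)) \<prec> ?h"
    show "P \<prec> ?q"
    proof (rule subordinate_one_minus_powr[OF P c])
      fix z assume z: "z \<in> \<U>"
      define x where "x = z * deriv P z / (c * P z)"
      have "k * (z * deriv P z / P z) = k * c * x"
        using c by (simp add: x_def)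
      also have "\<dots> = of_real (2 * (1 - \<alpha>)) * x"
        unfolding kc by simp
      finally have "Re (1 + k * (z * deriv P z / P z)) = 1 + 2 * (1 - \<alpha>) * Re x"
        by (simp only: plus_complex.sel one_complex.sel times_complex.sel Re_complex_of_real
            Im_complex_of_real mult_zero_left diff_zero)
      moreover have "Re (1 + k * (z * deriv P z / P z)) > \<alpha>"
        using sub z unfolding subordinate_half_plane_iff[OF \<alpha>] by blast
      ultimately have "(1 - \<alpha>) * (2 * Re x + 1) > 0"
        by (simp add: algebra_simps)
      then have "2 * Re x + 1 > 0"
        using \<alpha> by (simp add: zero_less_mult_iff)
      then show "Re (z * deriv P z / (c * P z)) > - 1 / 2"
        by (simp add: x_def)
    qed
  qed
  have pos: "Re (1 - z) > 0" if "z \<in> \<U>" for z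
    using that complex_Re_le_cmod[of z] by simp
  have nz: "1 - z \<noteq> 0" if "z \<in> \<U>" for z
    using that by auto
  have q_adm: "?q \<in> admissible"
    using univ nz by (auto simp: admissible_def univalent_def powr_def)
  have dq: "z * deriv ?q z / ?q z = c * z / (1 - z)" if z: "z \<in> \<U>" for z
  proof -
    have d1: "((\<lambda>z. 1 - z) has_field_derivative - 1) (at z)"
      by (auto intro!: derivative_eq_intros)
    have "(Ln has_field_derivative inverse (1 - z)) (at (1 - z))"
      using pos[OF z] by (intro has_field_derivative_Ln) (auto simp: complex_nonpos_Reals_iff)
    note dLn = DERIV_chain2[OF this d1]
    have "((\<lambda>z. exp (- c * Ln (1 - z))) has_field_derivative
        exp (- c * Ln (1 - z)) * (- c * (inverse (1 - z) * - 1))) (at z)"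
      by (rule DERIV_chain2[OF DERIV_exp DERIV_cmult[OF dLn]])
    then have "(?q has_field_derivative
        exp (- c * Ln (1 - z)) * (- c * (inverse (1 - z) * - 1))) (at z)"
      by (rule has_field_derivative_transform_within_open[where S = \<U>])
        (use z nz in \<open>auto simp: powr_def\<close>)
    then have "deriv ?q z = exp (- c * Ln (1 - z)) * (- c * (inverse (1 - z) * - 1))"
      by (rule DERIV_imp_deriv)
    then show ?thesis
      using nz[OF z] by (simp add: powr_def divide_inverse)
  qed
  have q_eq: "1 + k * (z * deriv ?q z / ?q z) = ?h z" if z: "z \<in> \<U>" for z
  proof -
    have "1 + k * (z * deriv ?q z / ?q z) = 1 + k * c * z / (1 - z)"
      unfolding dq[OF z] by simp
    also have "\<dots> = ?h z"
      unfolding kc using nz[OF z] by (simp add: field_simps)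
    finally show ?thesis .
  qed
  have "?h holomorphic_on \<U>"
    using nz by (intro holomorphic_intros) auto
  then have "?h \<prec> ?h"
    unfolding subordinate_def by (intro conjI exI[of _ "\<lambda>z. z"]) auto
  then have "(\<lambda>z. 1 + k * (z * deriv ?q z / ?q z)) \<prec> ?h"
    by (rule subordinate_transform) (rule q_eq[symmetric])
  then have "?q \<prec> r" if "dominant admissible (\<lambda>r s z. 1 + k * (s / r)) ?h r" for r
    using that q_adm unfolding dominant_def by blast
  then show ?thesis
    unfolding best_dominant_def using univ dom by blast
qed

theorem corollary3p1p4:
  fixes p :: nat and a b c :: complex and \<alpha> lam :: real
  assumes "p \<ge> 1" and "b \<noteq> 0" and "a \<noteq> 0"
    and "0 \<le> \<alpha>" and "\<alpha> < 1"
    and "- pi / 2 < lam" and "lam < pi / 2"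
    and c_eq: "c = 2 * of_nat p * a * b * complex_of_real (1 - \<alpha>)
                 * exp (- \<i> * complex_of_real lam) * complex_of_real (cos lam)"
    and "c \<in> set_B"
  shows
    "(\<forall>f \<in> class_K p lam \<alpha> b.
        branch_power (normalized_deriv p f) a \<prec> (\<lambda>z. 1 / (1 - z) powr c))
     \<and>
     (\<forall>f \<in> class_A p.
        (\<lambda>z. 1 + exp (\<i> * complex_of_real lam) / (b * complex_of_real (cos lam))
               * (1 / of_nat p * (1 + zf2_over_f1 p f z) - 1))
          \<prec> (\<lambda>z. (1 + (1 - 2 * complex_of_real \<alpha>) * z) / (1 - z))
        \<longrightarrow> branch_power (normalized_deriv p f) a \<prec> (\<lambda>z. 1 / (1 - z) powr c))
     \<and>
     (\<forall>f \<in> class_A p.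
        f \<in> class_K p lam \<alpha> b \<longleftrightarrow>
        (\<lambda>z. 1 + exp (\<i> * complex_of_real lam) / (b * complex_of_real (cos lam))
               * (1 / of_nat p * (1 + zf2_over_f1 p f z) - 1))
          \<prec> (\<lambda>z. (1 + (1 - 2 * complex_of_real \<alpha>) * z) / (1 - z)))
     \<and>
     best_dominant admissible
       (\<lambda>r s z. 1 + exp (\<i> * complex_of_real lam)
                     / (of_nat p * a * b * complex_of_real (cos lam)) * (s / r))
       (\<lambda>z. (1 + (1 - 2 * complex_of_real \<alpha>) * z) / (1 - z))
       (\<lambda>z. (1 - z) powr (- c))"
proof -
  let ?h = "\<lambda>z. (1 + (1 - 2 * complex_of_real \<alpha>) * z) / (1 - z)"
  let ?e = "exp (\<i> * complex_of_real lam)"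
  let ?\<Psi> = "\<lambda>f z. 1 + ?e / (b * complex_of_real (cos lam)) * (1 / of_nat p * (1 + zf2_over_f1 p f z) - 1)"
  define k where "k = ?e / (of_nat p * a * b * complex_of_real (cos lam))"
  have "cos lam > 0"
    using assms(6,7) by (intro cos_gt_zero_pi) auto
  then have cos: "cos lam \<noteq> 0"
    by simp
  have p0: "complex_of_nat p \<noteq> 0"
    using \<open>p \<ge> 1\<close> by simp
  have "?e * exp (- \<i> * complex_of_real lam) = 1"
    by (simp flip: exp_add)
  then have kc: "k * c = 2 * complex_of_real (1 - \<alpha>)"
    using p0 \<open>a \<noteq> 0\<close> \<open>b \<noteq> 0\<close> cos unfolding k_def c_eq by (simp add: field_simps)
  have best: "best_dominant admissible (\<lambda>r s z. 1 + k * (s / r)) ?h (\<lambda>z. (1 - z) powr (- c))"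
    by (rule best_dominant_one_minus_powr[OF \<open>\<alpha> < 1\<close> kc \<open>c \<in> set_B\<close>])
  have iff: "f \<in> class_K p lam \<alpha> b \<longleftrightarrow> ?\<Psi> f \<prec> ?h" if "f \<in> class_A p" for f
    by (rule class_K_iff_subordinate[OF that \<open>p \<ge> 1\<close> \<open>b \<noteq> 0\<close> \<open>\<alpha> < 1\<close> cos])
  have sub: "branch_power (normalized_deriv p f) a \<prec> (\<lambda>z. 1 / (1 - z) powr c)"
    if K: "f \<in> class_K p lam \<alpha> b" for f
  proof -
    define G where "G = normalized_deriv p f"
    define P where "P = branch_power G a"
    have f: "f \<in> class_A p" and nz: "\<And>z. z \<in> \<U> - {0} \<Longrightarrow> deriv f z \<noteq> 0"
      using K by (auto simp: class_K_def)
    have Gnz: "G z \<noteq> 0" if "z \<in> \<U>" for z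
      using nz[of z] that p0 by (simp add: G_def normalized_deriv_def)
    then have G: "G \<in> admissible"
      using normalized_deriv_holomorphic[OF f \<open>p \<ge> 1\<close>]
      by (simp add: admissible_def G_def normalized_deriv_def)
    \<comment> \<open>Passing from \<open>G\<close> to its power \<open>P\<close> multiplies the
      logarithmic derivative by \<open>a\<close>, which cancels the \<open>a\<close> in the
      denominator of \<open>k\<close>.\<close>
    have eq: "1 + k * (z * deriv P z / P z) = ?\<Psi> f z" if z: "z \<in> \<U>" for z
    proof -
      have "z * deriv P z / P z = a * (z * deriv G z / G z)"
        using branch_power_admissible(2)[OF G z] by (simp add: P_def flip: times_divide_eq_right)
      then have "k * (z * deriv P z / P z) =
          ?e / (b * complex_of_real (cos lam)) * (1 / of_nat p * (z * deriv G z / G z))"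
        using \<open>a \<noteq> 0\<close> by (simp add: k_def)
      moreover have "1 / of_nat p * (1 + zf2_over_f1 p f z) - 1 = 1 / of_nat p * (z * deriv G z / G z)"
        using zf2_over_f1_eq[OF f \<open>p \<ge> 1\<close> z] Gnz[OF z] p0
        unfolding G_def[symmetric] by (simp add: add_divide_distrib)
      ultimately show ?thesis
        by simp
    qed
    have "?\<Psi> f \<prec> ?h"
      using iff[OF f] K by blast
    then have "(\<lambda>z. 1 + k * (z * deriv P z / P z)) \<prec> ?h"
      by (rule subordinate_transform) (rule eq[symmetric])
    then have "P \<prec> (\<lambda>z. (1 - z) powr (- c))"
      using best branch_power_admissible(1)[OF G, of a]
      unfolding best_dominant_def dominant_def P_def by blast
    \<comment> \<open>The equality of total functions includes \<open>z = 1\<close>, where both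
      sides are 0 because \<open>0 powr w = 0\<close> and \<open>1 / 0 = 0\<close>.\<close>
    moreover have "(\<lambda>z. (1 - z) powr (- c)) = (\<lambda>z. 1 / (1 - z) powr c)"
      by (auto simp: fun_eq_iff powr_def exp_minus divide_inverse)
    ultimately show ?thesis
      by (simp add: P_def G_def)
  qed
  show ?thesis
    using sub iff best unfolding k_def by blast
qed

end
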